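(* Let $(M,\mathrm{acc},\mathrm{rej})$ be a monitoring system that is maximal for the collection of all properties. Then a property $P\subseteq\mathrm{Act}^\infty$ has a monitor in $M$ that is sound and violation-complete for it if and only if $P$ is a safety property; and $P$ has a monitor in $M$ that is sound and satisfaction-complete for it if and only if $P$ is a co-safety property.
   Context: $\mathrm{Act}$ is a finite set of actions, $\mathrm{Act}^\infty=\mathrm{Act}^*\cup\mathrm{Act}^\omega$; a property is a subset of $\mathrm{Act}^\infty$. A finite trace $s$ positively (resp. negatively) determines $P$ if $sf\in P$ (resp. $sf\notin P$) for all $f\in\mathrm{Act}^\infty$. $P$ is a safety property if every $f\notin P$ has a finite prefix that negatively determines $P$, and a co-safety property if every $f\in P$ has a finite prefix that positively determines $P$. A monitoring system is a triple $(M,\mathrm{acc},\mathrm{rej})$ with $M$ nonempty, $\mathrm{acc},\mathrm{rej}\subseteq M\times\mathrm{Act}^\infty$, such that for every $m$: (1) $\mathrm{acc}(m,f)$ implies $\mathrm{acc}(m,s)$ for some finite prefix $s$ of $f$, likewise for $\mathrm{rej}$; (2) $\mathrm{acc}(m,s)$ for finite $s$ implies $\mathrm{acc}(m,sf)$ for all $f$, likewise for $\mathrm{rej}$. It is maximal for a collection $C$ if for every $P\in C$ there is $m_P\in M$ with $\mathrm{acc}(m_P,f)$ iff $f$ has a finite prefix positively determining $P$, and $\mathrm{rej}(m_P,f)$ iff $f$ has a finite prefix negatively determining $P$. $m$ is sound for $P$ if $\mathrm{acc}(m,f)\Rightarrow f\in P$ and $\mathrm{rej}(m,f)\Rightarrow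 f\notin P$; satisfaction-complete if $f\in P\Rightarrow\mathrm{acc}(m,f)$; violation-complete if $f\notin P\Rightarrow\mathrm{rej}(m,f)$. *)

theory Defs
  imports "HOL-Library.Stream"
begin

datatype 'a trace = Fin "'a list" | Omega "'a stream"

definition traces :: "'a set \<Rightarrow> 'a trace set" where
  "traces Act = Fin ` lists Act \<union> Omega ` streams Act"

fun append_trace :: "'a list \<Rightarrow> 'a trace \<Rightarrow> 'a trace" (infixr \<open>\<frown>\<close> 65) where
  "s \<frown> Fin t = Fin (s @ t)"
| "s \<frown> Omega w = Omega (s @- w)"

text \<open>
  No alphabet is mentioned here: if \<open>f\<close> is a trace over \<open>Act\<close>, then so are \<open>s\<close> and \<open>g\<close>.
\<close>

definition finite_prefix :: "'a list \<Rightarrow> 'a trace \<Rightarrow> bool" where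
  "finite_prefix s f \<longleftrightarrow> (\<exists>g. f = s \<frown> g)"

definition pos_determines :: "'a set \<Rightarrow> 'a list \<Rightarrow> 'a trace set \<Rightarrow> bool" where
  "pos_determines Act s P \<longleftrightarrow> (\<forall>f\<in>traces Act. s \<frown> f \<in> P)"

definition neg_determines :: "'a set \<Rightarrow> 'a list \<Rightarrow> 'a trace set \<Rightarrow> bool" where
  "neg_determines Act s P \<longleftrightarrow> (\<forall>f\<in>traces Act. s \<frown> f \<notin> P)"

definition safety :: "'a set \<Rightarrow> 'a trace set \<Rightarrow> bool" where
  "safety Act P \<longleftrightarrow>
     (\<forall>f\<in>traces Act. f \<notin> P \<longrightarrow> (\<exists>s. finite_prefix s f \<and> neg_determines Act s P))"

definition cosafety :: "'a set \<Rightarrow> 'a trace set \<Rightarrow> bool" where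
  "cosafety Act P \<longleftrightarrow>
     (\<forall>f\<in>traces Act. f \<in> P \<longrightarrow> (\<exists>s. finite_prefix s f \<and> pos_determines Act s P))"

locale monitoring_system =
  fixes Act :: "'a set"
    and M :: "'m set"
    and acc rej :: "('m \<times> 'a trace) set"
  assumes nonempty: "M \<noteq> {}"
    and acc_subset: "acc \<subseteq> M \<times> traces Act"
    and rej_subset: "rej \<subseteq> M \<times> traces Act"
    and acc_prefix:
      "\<lbrakk>m \<in> M; f \<in> traces Act; (m, f) \<in> acc\<rbrakk>
       \<Longrightarrow> \<exists>s. finite_prefix s f \<and> (m, Fin s) \<in> acc"
    and rej_prefix:
      "\<lbrakk>m \<in> M; f \<in> traces Act; (m, f) \<in> rej\<rbrakk>
       \<Longrightarrow> \<exists>s. finite_prefix s f \<and> (m, Fin s) \<in> rej"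
    and acc_extend:
      "\<lbrakk>m \<in> M; s \<in> lists Act; (m, Fin s) \<in> acc; f \<in> traces Act\<rbrakk> \<Longrightarrow> (m, s \<frown> f) \<in> acc"
    and rej_extend:
      "\<lbrakk>m \<in> M; s \<in> lists Act; (m, Fin s) \<in> rej; f \<in> traces Act\<rbrakk> \<Longrightarrow> (m, s \<frown> f) \<in> rej"

definition maximal_for ::
  "'a set \<Rightarrow> 'm set \<Rightarrow> ('m \<times> 'a trace) set \<Rightarrow> ('m \<times> 'a trace) set \<Rightarrow> 'a trace set set \<Rightarrow> bool" where
  "maximal_for Act M acc rej C \<longleftrightarrow>
     (\<forall>P\<in>C. \<exists>m\<in>M. \<forall>f\<in>traces Act.
        ((m, f) \<in> acc \<longleftrightarrow> (\<exists>s. finite_prefix s f \<and> pos_determines Act s P)) \<and>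
        ((m, f) \<in> rej \<longleftrightarrow> (\<exists>s. finite_prefix s f \<and> neg_determines Act s P)))"

definition sound ::
  "'a set \<Rightarrow> ('m \<times> 'a trace) set \<Rightarrow> ('m \<times> 'a trace) set \<Rightarrow> 'm \<Rightarrow> 'a trace set \<Rightarrow> bool" where
  "sound Act acc rej m P \<longleftrightarrow>
     (\<forall>f\<in>traces Act. ((m, f) \<in> acc \<longrightarrow> f \<in> P) \<and> ((m, f) \<in> rej \<longrightarrow> f \<notin> P))"

definition satisfaction_complete ::
  "'a set \<Rightarrow> ('m \<times> 'a trace) set \<Rightarrow> 'm \<Rightarrow> 'a trace set \<Rightarrow> bool" where
  "satisfaction_complete Act acc m P \<longleftrightarrow> (\<forall>f\<in>traces Act. f \<in> P \<longrightarrow> (m, f) \<in> acc)"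

definition violation_complete ::
  "'a set \<Rightarrow> ('m \<times> 'a trace) set \<Rightarrow> 'm \<Rightarrow> 'a trace set \<Rightarrow> bool" where
  "violation_complete Act rej m P \<longleftrightarrow> (\<forall>f\<in>traces Act. f \<notin> P \<longrightarrow> (m, f) \<in> rej)"

end

theory Submission
  imports Defs
begin

text \<open>A verdict on a trace is already reached on some finite prefix \<open>s\<close> and
  persists on every extension of \<open>s\<close>. If the monitor is sound, this persistence says
  exactly that \<open>s\<close> determines \<open>P\<close>; completeness supplies such a verdict
  for every violating (resp. satisfying) trace, so \<open>P\<close> is safety (resp. co-safety):
  \<open>sound_violation_complete_imp_safety\<close> and its dual. Conversely, the monitor that
  maximality provides for \<open>P\<close> is always sound, and its completeness is the definition
  of safety (resp. co-safety) itself: \<open>maximal_for_obtains_sound_monitor\<close>.\<close>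

text \<open>Recovers the alphabet that \<open>finite_prefix\<close> leaves implicit, so that the
  remainder after a prefix falls under the quantifier over \<open>traces Act\<close> in the
  determination predicates.\<close>

lemma append_trace_in_traces_iff:
  "s \<frown> g \<in> traces Act \<longleftrightarrow> s \<in> lists Act \<and> g \<in> traces Act"
  by (cases g) (auto simp: traces_def image_iff streams_iff_sset)

lemma finite_prefix_in_tracesE:
  assumes "finite_prefix s f" and "f \<in> traces Act"
  obtains g where "f = s \<frown> g" "s \<in> lists Act" "g \<in> traces Act"
  using assms by (auto simp: finite_prefix_def append_trace_in_traces_iff)

lemma pos_determines_prefix_imp_mem:
  assumes "finite_prefix s f" and "f \<in> traces Act" and "pos_determines Act s P"
  shows "f \<in> P"
  using assms by (auto simp: pos_determines_def elim: finite_prefix_in_tracesE)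

lemma neg_determines_prefix_imp_not_mem:
  assumes "finite_prefix s f" and "f \<in> traces Act" and "neg_determines Act s P"
  shows "f \<notin> P"
  using assms by (auto simp: neg_determines_def elim: finite_prefix_in_tracesE)

context monitoring_system
begin

lemma sound_violation_complete_imp_safety:
  assumes "m \<in> M" and "sound Act acc rej m P" and "violation_complete Act rej m P"
  shows "safety Act P"
  unfolding safety_def
proof (intro ballI impI)
  fix f assume f: "f \<in> traces Act" and "f \<notin> P"
  then have "(m, f) \<in> rej"
    using assms(3) by (simp add: violation_complete_def)
  then obtain s where s: "finite_prefix s f" "(m, Fin s) \<in> rej"
    using rej_prefix \<open>m \<in> M\<close> f by blast
  \<comment> \<open>\<open>rej_extend\<close> speaks only of finite words over \<open>Act\<close>;
    \<open>s\<close> inherits the alphabet from \<open>f\<close>.\<close>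
  have "s \<in> lists Act"
    using s(1) f by (rule finite_prefix_in_tracesE)
  have "neg_determines Act s P"
    unfolding neg_determines_def
  \<comment> \<open>Rejection of \<open>s\<close> persists on every extension, and soundness puts
    each rejected trace outside \<open>P\<close>.\<close>
  proof
    fix g assume "g \<in> traces Act"
    then have "(m, s \<frown> g) \<in> rej" "s \<frown> g \<in> traces Act"
      using rej_extend \<open>m \<in> M\<close> \<open>s \<in> lists Act\<close> s(2)
      by (simp_all add: append_trace_in_traces_iff)
    then show "s \<frown> g \<notin> P"
      using assms(2) by (simp add: sound_def)
  qed
  with s(1) show "\<exists>s. finite_prefix s f \<and> neg_determines Act s P"
    by blast
qed

text \<open>Dual argument: acceptance of a finite prefix persists, and soundness puts every
  extension inside \<open>P\<close>.\<close>

lemma sound_satisfaction_complete_imp_cosafety: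
  assumes "m \<in> M" and "sound Act acc rej m P" and "satisfaction_complete Act acc m P"
  shows "cosafety Act P"
  unfolding cosafety_def
proof (intro ballI impI)
  fix f assume f: "f \<in> traces Act" and "f \<in> P"
  then have "(m, f) \<in> acc"
    using assms(3) by (simp add: satisfaction_complete_def)
  then obtain s where s: "finite_prefix s f" "(m, Fin s) \<in> acc"
    using acc_prefix \<open>m \<in> M\<close> f by blast
  have "s \<in> lists Act"
    using s(1) f by (rule finite_prefix_in_tracesE)
  have "pos_determines Act s P"
    unfolding pos_determines_def
  proof
    fix g assume "g \<in> traces Act"
    then have "(m, s \<frown> g) \<in> acc" "s \<frown> g \<in> traces Act"
      using acc_extend \<open>m \<in> M\<close> \<open>s \<in> lists Act\<close> s(2)
      by (simp_all add: append_trace_in_traces_iff)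
    then show "s \<frown> g \<in> P"
      using assms(2) by (simp add: sound_def)
  qed
  with s(1) show "\<exists>s. finite_prefix s f \<and> pos_determines Act s P"
    by blast
qed

end

text \<open>Soundness holds for arbitrary \<open>P\<close> in \<open>C\<close>, since a determining
  prefix decides membership of the trace itself. Only completeness depends on the kind of property,
  hence the two implications about a single \<open>m\<close>, which serves both
  equivalences.\<close>

lemma maximal_for_obtains_sound_monitor:
  assumes "maximal_for Act M acc rej C" and "P \<in> C"
  obtains m where "m \<in> M" "sound Act acc rej m P"
    "safety Act P \<longrightarrow> violation_complete Act rej m P"
    "cosafety Act P \<longrightarrow> satisfaction_complete Act acc m P"
proof -
  obtain m where "m \<in> M" and *: "\<forall>f\<in>traces Act.
      ((m, f) \<in> acc \<longleftrightarrow> (\<exists>s. finite_prefix s f \<and> pos_determines Act s P)) \<and>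
      ((m, f) \<in> rej \<longleftrightarrow> (\<exists>s. finite_prefix s f \<and> neg_determines Act s P))"
    using bspec[OF assms(1)[unfolded maximal_for_def] assms(2)] by (rule bexE)
  \<comment> \<open>Splits the characterisation into conditional rewrite rules: \<open>m(1)\<close>
    for \<open>acc\<close>, \<open>m(2)\<close> for \<open>rej\<close>.\<close>
  note m = * [THEN bspec, THEN conjunct1] * [THEN bspec, THEN conjunct2]
  show thesis
  proof (rule that)
    show "m \<in> M" by fact
    show "sound Act acc rej m P"
      by (auto simp: sound_def m dest: pos_determines_prefix_imp_mem
          neg_determines_prefix_imp_not_mem)
    show "safety Act P \<longrightarrow> violation_complete Act rej m P"
      by (simp add: m(2) safety_def violation_complete_def)
    show "cosafety Act P \<longrightarrow> satisfaction_complete Act acc m P"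
      by (simp add: m(1) cosafety_def satisfaction_complete_def)
  qed
qed

theorem theorem6:
  fixes Act :: "'a set" and M :: "'m set"
    and acc rej :: "('m \<times> 'a trace) set"
    and P :: "'a trace set"
  assumes "finite Act"
    and "monitoring_system Act M acc rej"
    and "maximal_for Act M acc rej (Pow (traces Act))"
    and "P \<subseteq> traces Act"
  shows "((\<exists>m\<in>M. sound Act acc rej m P \<and> violation_complete Act rej m P) \<longleftrightarrow> safety Act P) \<and>
         ((\<exists>m\<in>M. sound Act acc rej m P \<and> satisfaction_complete Act acc m P) \<longleftrightarrow> cosafety Act P)"
proof -
  interpret monitoring_system Act M acc rej by fact
  have "P \<in> Pow (traces Act)"
    using assms(4) by simp
  with assms(3) obtain m where "m \<in> M" "sound Act acc rej m P"
    "safety Act P \<longrightarrow> violation_complete Act rej m P"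
    "cosafety Act P \<longrightarrow> satisfaction_complete Act acc m P"
    by (rule maximal_for_obtains_sound_monitor)
  \<comment> \<open>The monitor \<open>m\<close> witnesses both right-to-left directions; the other
    two hold for any monitor in \<open>M\<close>.\<close>
  then show ?thesis
    by (metis sound_violation_complete_imp_safety sound_satisfaction_complete_imp_cosafety)
qed

end
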